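(* Let $G=(\mathbb Z/4)*(\mathbb Z/4)$, let $g\in G^0$ be a drifter, and let $s>0$ be irrational. For any $N>0$ and any $z\in\mathbb C$, the map $g_{s,z}$ has only finitely many periodic islands of period less than $N$. Moreover, for all but countably many choices of $z\in\mathbb C$, the map $g_{s,z}$ has no periodic points at all.
   Context: For $s>0$ and $z\in\mathbb C$, let $G_{s,z}$ be the infinite grid of squares of side length $s$ in $\mathbb C$, with sides parallel to the coordinate axes, having $z$ as a vertex. Let $R_{s,z}$ be the map, defined on the interiors of the squares of $G_{s,z}$, which rotates each square about its own center clockwise by $\pi/2$. Let $A_1,A_2$ be the standard generators of the free product $G=(\mathbb Z/4)*(\mathbb Z/4)$. Let $G^0\subset G$ be the index $4$ subgroup of words whose total exponent is divisible by $4$. Given $s>0$ and $z\in\mathbb C$, for $g\in G$ let $g_{s,z}$ be the partially defined map of $\mathbb C$ obtained from the reduced word representing $g$ by replacing $A_1$ with $R_{1,0}$ and $A_2$ with $R_{s,z}$ and composing (it is defined at a point when every successive map in the composition is defined). When $g\in G^0$, $g_{s,z}$ is a piecewise translation (an infinite rectangle exchange). Let $H:G\to \mathrm{Isom}(\mathbb C)$ be the homomorphism for which $H(A_1)$ is the counterclockwise rotation by $\pi/2$ about $0$ and $H(A_2)$ is the counterclockwise rotation by $\pi/2$ about $1$. A word $g\in G^0$ is a drifter if $H(g)$ is not the identity. For a piecewise translation $R$ and a periodic point $p$ of $R$, the periodic island of $p$ is the maximal open convex polygon containing $p$ on which $R$ (and its iterates) are entirely defined and periodic; its period is the period of $p$.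 *)

theory Defs
  imports "HOL-Analysis.Analysis" "HOL-Algebra.Coset"
begin

section \<open>The free product of two cyclic groups of order four\<close>

datatype gen = A1 | A2

text \<open>Since \<open>A\<^sub>i\<close> has order four, every element of the free product has a unique expression as a
  word with positive exponents containing no four consecutive equal letters; a syllable
  \<open>A\<^sub>i\<^sup>k\<close> with \<open>k \<in> {1,2,3}\<close> is written as \<open>k\<close> copies of \<open>A\<^sub>i\<close>.\<close>

primrec reduced_word :: "gen list \<Rightarrow> bool" where
  "reduced_word [] \<longleftrightarrow> True"
| "reduced_word (a # w) \<longleftrightarrow> take 3 w \<noteq> [a, a, a] \<and> reduced_word w"

text \<open>The reduced form of \<open>a \<cdot> w\<close>, for reduced \<open>w\<close>.\<close>

definition push :: "gen \<Rightarrow> gen list \<Rightarrow> gen list" where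
  "push a w = (if take 3 w = [a, a, a] then drop 3 w else a # w)"

definition Z4_Z4 :: "gen list monoid" where
  "Z4_Z4 = \<lparr>carrier = {w. reduced_word w}, mult = foldr push, one = []\<rparr>"

lemma reduced_drop: "reduced_word w \<Longrightarrow> reduced_word (drop n w)"
proof (induction w arbitrary: n)
  case (Cons a w)
  then show ?case by (cases n) auto
qed simp

lemma reduced_push: "reduced_word w \<Longrightarrow> reduced_word (push a w)"
  by (simp add: push_def reduced_drop)

lemma reduced_foldr_push: "reduced_word w \<Longrightarrow> reduced_word (foldr push u w)"
  by (induction u) (auto simp: reduced_push)

lemma push_reduced_Cons: "reduced_word (a # w) \<Longrightarrow> push a w = a # w"
  by (simp add: push_def)

lemma take3_eq: "take 3 w = [a, b, c] \<longleftrightarrow> (\<exists>v. w = a # b # c # v)"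
  by (cases w; cases "tl w"; cases "tl (tl w)") (auto simp: eval_nat_numeral)

lemma push_triple: "push a (a # a # a # v) = v"
  by (simp add: push_def eval_nat_numeral)

lemma push_not_triple: "\<nexists>v. w = a # a # a # v \<Longrightarrow> push a w = a # w"
  by (simp add: push_def take3_eq)

lemma push_four:
  assumes "reduced_word w"
  shows "push a (push a (push a (push a w))) = w"
proof -
  consider (0) "\<nexists>v. w = a # v"
    | (1) v where "w = a # v" "\<nexists>u. v = a # u"
    | (2) v where "w = a # a # v" "\<nexists>u. v = a # u"
    | (3) v where "w = a # a # a # v" "\<nexists>u. v = a # u"
  proof -
    have "\<nexists>u. w = a # a # a # a # u"
      using assms by (auto simp: take3_eq)
    then show ?thesis
      using that by blast
  qed
  then show ?thesis
    by cases (simp_all add: push_triple push_not_triple)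
qed

lemma foldr_push_push:
  assumes "reduced_word w"
  shows "foldr push (push a v) w = push a (foldr push v w)"
proof (cases "take 3 v = [a, a, a]")
  case True
  then obtain v' where "v = a # a # a # v'"
    by (auto simp: take3_eq)
  then show ?thesis
    using push_four[OF reduced_foldr_push[OF assms], of a v'] by (simp add: push_triple)
qed (simp add: push_def)

lemma foldr_push_assoc:
  "reduced_word w \<Longrightarrow> foldr push (foldr push u v) w = foldr push u (foldr push v w)"
  by (induction u) (simp_all add: foldr_push_push)

lemma foldr_push_Nil: "reduced_word u \<Longrightarrow> foldr push u [] = u"
  by (induction u) (simp_all add: push_def)

lemma left_inverse_exists: "reduced_word u \<Longrightarrow> \<exists>y. reduced_word y \<and> foldr push y u = []"
proof (induction u)
  case Nil
  show ?case by (intro exI[of _ "[]"]) simp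
next
  case (Cons a u)
  then obtain y where y: "reduced_word y" "foldr push y u = []" by auto
  have "foldr push (foldr push y [a, a, a]) (a # u) = foldr push y (foldr push [a, a, a] (a # u))"
    using Cons.prems by (rule foldr_push_assoc)
  also have "foldr push [a, a, a] (a # u) = u"
    using Cons.prems push_four[of u a] by (simp add: push_reduced_Cons)
  finally have "foldr push (foldr push y [a, a, a]) (a # u) = []"
    using y by simp
  moreover have "reduced_word (foldr push y [a, a, a])"
    by (intro reduced_foldr_push) (simp add: eval_nat_numeral)
  ultimately show ?case by blast
qed

lemma group_Z4_Z4: "group Z4_Z4"
proof (rule groupI)
  fix x assume "x \<in> carrier Z4_Z4"
  then show "\<exists>y\<in>carrier Z4_Z4. y \<otimes>\<^bsub>Z4_Z4\<^esub> x = \<one>\<^bsub>Z4_Z4\<^esub>"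
    using left_inverse_exists[of x] by (auto simp: Z4_Z4_def)
qed (auto simp: Z4_Z4_def reduced_foldr_push foldr_push_assoc)

text \<open>The universal property of the free product: for elements \<open>h A1\<close>, \<open>h A2\<close> of a group with
  fourth power \<open>\<one>\<close> there is exactly one homomorphism from \<open>Z4_Z4\<close> sending \<open>A\<^sub>i\<close> to \<open>h A\<^sub>i\<close>.\<close>

definition word_value :: "('a, 'b) monoid_scheme \<Rightarrow> (gen \<Rightarrow> 'a) \<Rightarrow> gen list \<Rightarrow> 'a" where
  "word_value K h w = foldr (\<lambda>a x. h a \<otimes>\<^bsub>K\<^esub> x) w \<one>\<^bsub>K\<^esub>"

lemma word_value_simps [simp]:
  "word_value K h [] = \<one>\<^bsub>K\<^esub>"
  "word_value K h (a # w) = h a \<otimes>\<^bsub>K\<^esub> word_value K h w"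
  by (simp_all add: word_value_def)

lemma (in group) word_value_closed:
  "(\<And>a. h a \<in> carrier G) \<Longrightarrow> word_value G h w \<in> carrier G"
  by (induction w) auto

lemma (in group) word_value_push:
  assumes "\<And>a. h a \<in> carrier G" "\<And>a. h a [^] (4::nat) = \<one>"
  shows "word_value G h (push a w) = h a \<otimes> word_value G h w"
proof (cases "take 3 w = [a, a, a]")
  case True
  then obtain v where v: "w = a # a # a # v"
    by (auto simp: take3_eq)
  have "h a \<otimes> word_value G h w = h a [^] (4::nat) \<otimes> word_value G h v"
    using assms(1) by (simp add: v eval_nat_numeral m_assoc word_value_closed)
  then show ?thesis
    using assms by (simp add: v push_triple word_value_closed)
qed (simp add: push_def)

lemma (in group) word_value_hom:
  assumes "\<And>a. h a \<in> carrier G" "\<And>a. h a [^] (4::nat) = \<one>"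
  shows "word_value G h \<in> hom Z4_Z4 G"
proof (rule homI)
  fix u v
  show "word_value G h (u \<otimes>\<^bsub>Z4_Z4\<^esub> v) = word_value G h u \<otimes> word_value G h v"
    by (induction u)
       (simp_all add: Z4_Z4_def assms word_value_push word_value_closed m_assoc)
qed (simp add: assms word_value_closed)

lemma (in group) hom_eq_word_value:
  assumes "f \<in> hom Z4_Z4 G" "\<And>a. f [a] = h a" "reduced_word w"
  shows "f w = word_value G h w"
  using assms(3)
proof (induction w)
  case Nil
  show ?case
    using hom_one[OF assms(1) group_Z4_Z4 is_group] by (simp add: Z4_Z4_def)
next
  case (Cons a w)
  have "f (a # w) = f ([a] \<otimes>\<^bsub>Z4_Z4\<^esub> w)"
    using Cons.prems by (simp add: Z4_Z4_def push_reduced_Cons)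
  also have "\<dots> = f [a] \<otimes> f w"
    by (rule hom_mult[OF assms(1)]) (use Cons.prems in \<open>simp_all add: Z4_Z4_def\<close>)
  finally show ?case
    using Cons assms(2) by simp
qed

definition G0 :: "gen list set" where
  "G0 = {w \<in> carrier Z4_Z4. 4 dvd length w}"

lemma length_push: "length (push a w) mod 4 = Suc (length w) mod 4"
  by (cases "take 3 w = [a, a, a]") (auto simp: take3_eq push_triple push_def)

lemma length_mult: "length (u \<otimes>\<^bsub>Z4_Z4\<^esub> v) mod 4 = (length u + length v) mod 4"
proof (induction u)
  case (Cons a u)
  have "length (push a (foldr push u v)) mod 4 = Suc (length (foldr push u v) mod 4) mod 4"
    by (simp add: length_push mod_Suc_eq)
  with Cons show ?case
    by (simp add: Z4_Z4_def mod_Suc_eq)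
qed (simp add: Z4_Z4_def)

lemma subgroup_G0: "subgroup G0 Z4_Z4"
proof -
  interpret group Z4_Z4 by (rule group_Z4_Z4)
  show ?thesis
  proof (rule subgroupI)
    fix a assume a: "a \<in> G0"
    then have "length (inv\<^bsub>Z4_Z4\<^esub> a \<otimes>\<^bsub>Z4_Z4\<^esub> a) = 0"
      by (subst l_inv) (auto simp: G0_def, simp add: Z4_Z4_def)
    then show "inv\<^bsub>Z4_Z4\<^esub> a \<in> G0"
      using a length_mult[of "inv\<^bsub>Z4_Z4\<^esub> a" a]
      by (simp add: G0_def flip: dvd_eq_mod_eq_0) (metis dvd_add_left_iff)
  next
    fix a b assume "a \<in> G0" "b \<in> G0"
    then show "a \<otimes>\<^bsub>Z4_Z4\<^esub> b \<in> G0"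
      using length_mult[of a b] by (simp add: G0_def) presburger
  next
    have "[] \<in> G0" by (simp add: G0_def Z4_Z4_def)
    then show "G0 \<noteq> {}" by blast
  qed (auto simp: G0_def)
qed


section \<open>Drifters\<close>

definition Isom :: "(complex \<Rightarrow> complex) monoid" where
  "Isom = \<lparr>carrier = {f. surj f \<and> (\<forall>x y. dist (f x) (f y) = dist x y)}, mult = (\<circ>), one = id\<rparr>"

lemma group_Isom: "group Isom"
proof (rule groupI)
  fix f assume "f \<in> carrier Isom"
  then have f: "surj f" "\<And>x y. dist (f x) (f y) = dist x y"
    by (auto simp: Isom_def)
  have "inj f"
    by (rule injI) (metis dist_eq_0_iff f(2))
  moreover have "dist (inv_into UNIV f x) (inv_into UNIV f y) = dist x y" for x y
    by (metis f surj_f_inv_f)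
  ultimately have "inv_into UNIV f \<in> carrier Isom"
    by (simp add: Isom_def inj_imp_surj_inv)
  moreover have "inv_into UNIV f \<otimes>\<^bsub>Isom\<^esub> f = \<one>\<^bsub>Isom\<^esub>"
    using \<open>inj f\<close> by (simp add: Isom_def)
  ultimately show "\<exists>g\<in>carrier Isom. g \<otimes>\<^bsub>Isom\<^esub> f = \<one>\<^bsub>Isom\<^esub>" by blast
qed (auto simp: Isom_def comp_surj[unfolded comp_def] comp_assoc)

definition rot_ccw :: "complex \<Rightarrow> complex \<Rightarrow> complex" where
  "rot_ccw c p = c + \<i> * (p - c)"

definition rot_cw :: "complex \<Rightarrow> complex \<Rightarrow> complex" where
  "rot_cw c p = c - \<i> * (p - c)"

primrec H_gen :: "gen \<Rightarrow> complex \<Rightarrow> complex" where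
  "H_gen A1 = rot_ccw 0"
| "H_gen A2 = rot_ccw 1"

definition H :: "gen list \<Rightarrow> complex \<Rightarrow> complex" where
  "H = word_value Isom H_gen"

lemma H_gen_Isom: "H_gen a \<in> carrier Isom"
proof -
  have "surj (rot_ccw c)" for c
    by (rule surjI[of _ "rot_cw c"]) (simp add: rot_ccw_def rot_cw_def algebra_simps)
  moreover have "dist (rot_ccw c x) (rot_ccw c y) = dist x y" for c x y
  proof -
    have "rot_ccw c x - rot_ccw c y = \<i> * (x - y)"
      by (simp add: rot_ccw_def algebra_simps)
    then show ?thesis by (simp add: dist_norm norm_mult)
  qed
  ultimately show ?thesis by (cases a) (simp_all add: Isom_def)
qed

lemma H_hom: "H \<in> hom Z4_Z4 Isom"
proof -
  interpret Isom: group Isom by (rule group_Isom)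
  have "H_gen a [^]\<^bsub>Isom\<^esub> (4::nat) = \<one>\<^bsub>Isom\<^esub>" for a
    by (cases a)
       (auto simp: Isom_def nat_pow_def eval_nat_numeral rot_ccw_def algebra_simps fun_eq_iff)
  then show ?thesis
    unfolding H_def using H_gen_Isom by (intro Isom.word_value_hom)
qed

lemma H_generator: "H [a] = H_gen a"
  by (simp add: H_def Isom_def)

definition drifter :: "gen list \<Rightarrow> bool" where
  "drifter g \<longleftrightarrow> g \<in> G0 \<and> H g \<noteq> id"


section \<open>Square turning maps\<close>

definition grid_square :: "real \<Rightarrow> complex \<Rightarrow> int \<times> int \<Rightarrow> complex set" where
  "grid_square s z = (\<lambda>(m, n).
     cbox (z + of_real s * Complex m n) (z + of_real s * Complex (m + 1) (n + 1)))"

definition square_centre :: "real \<Rightarrow> complex \<Rightarrow> int \<times> int \<Rightarrow> complex" where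
  "square_centre s z = (\<lambda>(m, n). z + of_real s * Complex (m + 1 / 2) (n + 1 / 2))"

definition square_turn :: "real \<Rightarrow> complex \<Rightarrow> complex \<rightharpoonup> complex" where
  "square_turn s z p =
     (if \<exists>k. p \<in> interior (grid_square s z k)
      then Some (rot_cw (square_centre s z (THE k. p \<in> interior (grid_square s z k))) p)
      else None)"

lemma interior_grid_square:
  "p \<in> interior (grid_square s z (m, n)) \<longleftrightarrow>
     Re z + s * m < Re p \<and> Re p < Re z + s * (m + 1) \<and>
     Im z + s * n < Im p \<and> Im p < Im z + s * (n + 1)"
  by (auto simp: grid_square_def interior_cbox in_box_complex_iff)

lemma square_turn_eq:
  assumes "s > 0" "p \<in> interior (grid_square s z k)"
  shows "square_turn s z p = Some (rot_cw (square_centre s z k) p)"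
proof -
  have le: "a \<le> b" if "c + s * real_of_int a < x" "x < c + s * (real_of_int b + 1)" for a b c x
  proof -
    have "s * real_of_int a < s * (real_of_int b + 1)" using that by linarith
    then show ?thesis using \<open>s > 0\<close> by (simp add: mult_less_cancel_left_pos)
  qed
  have "(THE k. p \<in> interior (grid_square s z k)) = k"
  proof (rule the_equality)
    show "p \<in> interior (grid_square s z k)" by (rule assms(2))
  next
    fix l assume "p \<in> interior (grid_square s z l)"
    with assms(2) show "l = k"
      by (cases k; cases l) (auto simp: interior_grid_square intro: antisym le)
  qed
  moreover have "\<exists>k. p \<in> interior (grid_square s z k)"
    using assms(2) by blast
  ultimately show ?thesis by (simp only: square_turn_def if_True)
qed

primrec gen_map :: "real \<Rightarrow> complex \<Rightarrow> gen \<Rightarrow> complex \<rightharpoonup> complex" where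
  "gen_map s z A1 = square_turn 1 0"
| "gen_map s z A2 = square_turn s z"

text \<open>As in \<open>H\<close>, the rightmost letter of the word is applied first.\<close>

definition word_map :: "gen list \<Rightarrow> real \<Rightarrow> complex \<Rightarrow> complex \<rightharpoonup> complex" where
  "word_map g s z = foldr (\<lambda>a f. gen_map s z a \<circ>\<^sub>m f) g Some"


section \<open>Periodic points and islands of partial maps\<close>

definition iterate :: "('a \<rightharpoonup> 'a) \<Rightarrow> nat \<Rightarrow> 'a \<rightharpoonup> 'a" where
  "iterate R n = ((\<lambda>f. R \<circ>\<^sub>m f) ^^ n) Some"

definition periodic_point :: "('a \<rightharpoonup> 'a) \<Rightarrow> 'a \<Rightarrow> bool" where
  "periodic_point R p \<longleftrightarrow> (\<exists>n>0. iterate R n p = Some p)"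

definition period :: "('a \<rightharpoonup> 'a) \<Rightarrow> 'a \<Rightarrow> nat" where
  "period R p = (LEAST n. n > 0 \<and> iterate R n p = Some p)"

definition open_convex_polygon :: "complex set \<Rightarrow> bool" where
  "open_convex_polygon U \<longleftrightarrow> (\<exists>P. polytope P \<and> U = interior P \<and> U \<noteq> {})"

text \<open>A point is periodic only if all its iterates are defined. On a connected open set on which
  every iterate of a piecewise translation is defined, each iterate is a single translation, so
  pointwise periodicity there forces all points to have the same period.\<close>

definition periodic_polygon :: "(complex \<rightharpoonup> complex) \<Rightarrow> complex set \<Rightarrow> bool" where
  "periodic_polygon R U \<longleftrightarrow> open_convex_polygon U \<and> (\<forall>q\<in>U. periodic_point R q)"

definition periodic_island :: "(complex \<rightharpoonup> complex) \<Rightarrow> complex \<Rightarrow> complex set \<Rightarrow> bool" where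
  "periodic_island R p U \<longleftrightarrow>
     p \<in> U \<and> periodic_polygon R U \<and> (\<forall>V. periodic_polygon R V \<and> U \<subseteq> V \<longrightarrow> V = U)"

end

(* A word of length L sends p to (-i)^L p + a + s b + z t, where a and b are Gaussian integers
   depending on the squares visited and t depends only on the word.  If 4 divides L, then the
   translation H(g) is by the conjugate of t, so g is a drifter iff t is nonzero.  A point of
   period n satisfies a + s b = - n t z.  Only countably many z solve such an equation.  For fixed z
   and irrational s the equation determines a; since a square visited by the orbit of p has index
   p + O(1) in the unit grid, a = - n t p + O(1), so p ranges over a bounded set.  Hence the
   orbit visits finitely many possible sequences of squares, and an island consists of all points
   with a given such sequence. *)
theory Submission
  imports Defs
begin

section \<open>Itineraries, their cells, and word maps\<close>

primrec side :: "real \<Rightarrow> gen \<Rightarrow> real" where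
  "side s A1 = 1"
| "side s A2 = s"

primrec corner :: "complex \<Rightarrow> gen \<Rightarrow> complex" where
  "corner z A1 = 0"
| "corner z A2 = z"

lemma gen_map_eq: "gen_map s z a = square_turn (side s a) (corner z a)"
  by (cases a) auto

abbreviation tile :: "real \<Rightarrow> complex \<Rightarrow> gen \<times> int \<times> int \<Rightarrow> complex set" where
  "tile s z x \<equiv> grid_square (side s (fst x)) (corner z (fst x)) (snd x)"

abbreviation centre :: "real \<Rightarrow> complex \<Rightarrow> gen \<times> int \<times> int \<Rightarrow> complex" where
  "centre s z x \<equiv> square_centre (side s (fst x)) (corner z (fst x)) (snd x)"

text \<open>Itineraries list the squares visited in the order of the letters of a word, so the head is
  visited last.\<close>

primrec follow :: "real \<Rightarrow> complex \<Rightarrow> (gen \<times> int \<times> int) list \<Rightarrow> complex \<Rightarrow> complex" where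
  "follow s z [] p = p"
| "follow s z (x # c) p = rot_cw (centre s z x) (follow s z c p)"

text \<open>Any list of squares counts as an itinerary; one that no point realises has an empty
  cell.\<close>

primrec cell :: "real \<Rightarrow> complex \<Rightarrow> (gen \<times> int \<times> int) list \<Rightarrow> complex set" where
  "cell s z [] = UNIV"
| "cell s z (x # c) = cell s z c \<inter> follow s z c -` interior (tile s z x)"

lemma square_turn_Some_iff:
  assumes "s > 0"
  shows "square_turn s z p = Some q \<longleftrightarrow>
    (\<exists>k. p \<in> interior (grid_square s z k) \<and> q = rot_cw (square_centre s z k) p)"
proof
  assume L: "square_turn s z p = Some q"
  then obtain k where "p \<in> interior (grid_square s z k)"
    by (auto simp: square_turn_def split: if_splits)
  with L square_turn_eq[OF assms this]
  show "\<exists>k. p \<in> interior (grid_square s z k) \<and> q = rot_cw (square_centre s z k) p"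
    by (metis option.inject)
next
  assume "\<exists>k. p \<in> interior (grid_square s z k) \<and> q = rot_cw (square_centre s z k) p"
  then show "square_turn s z p = Some q"
    using square_turn_eq[OF assms] by auto
qed

lemma side_pos: "s > 0 \<Longrightarrow> side s a > 0"
  by (cases a) auto

lemma word_map_Cons: "word_map (a # w) s z = gen_map s z a \<circ>\<^sub>m word_map w s z"
  by (simp add: word_map_def)

lemma word_map_Nil: "word_map [] s z = Some"
  by (simp add: word_map_def)

lemma word_map_cell:
  assumes "s > 0" "p \<in> cell s z c"
  shows "word_map (map fst c) s z p = Some (follow s z c p)"
  using assms(2)
proof (induction c)
  case (Cons x c)
  then show ?case
    using square_turn_eq[OF side_pos[OF assms(1)]] by (simp add: word_map_Cons map_comp_def gen_map_eq)
qed (simp add: word_map_Nil)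

text \<open>Recording the square met at each letter splits the domain of a word map into cells, on
  each of which the map is the single isometry \<open>follow\<close>.\<close>

lemma word_map_Some_cell:
  assumes "s > 0" "word_map w s z p = Some q"
  obtains c where "map fst c = w" "p \<in> cell s z c" "follow s z c p = q"
  using assms(2)
proof (induction w arbitrary: q thesis)
  case Nil
  then show ?case by (simp add: word_map_Nil)
next
  case (Cons a w)
  then obtain r where r: "word_map w s z p = Some r" "gen_map s z a r = Some q"
    by (auto simp: word_map_Cons map_comp_def split: option.splits)
  obtain c where c: "map fst c = w" "p \<in> cell s z c" "follow s z c p = r"
    using Cons.IH[OF _ r(1)] by blast
  obtain k where "r \<in> interior (grid_square (side s a) (corner z a) k)"
      "q = rot_cw (square_centre (side s a) (corner z a) k) r"
    using r(2) square_turn_Some_iff[OF side_pos[OF assms(1)]] unfolding gen_map_eq by blast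
  with c show ?case by (intro Cons.prems(1)[of "(a, k) # c"]) auto
qed

lemma word_map_append: "word_map (u @ v) s z = word_map u s z \<circ>\<^sub>m word_map v s z"
proof (induction u)
  case (Cons a u)
  then show ?case
    by (auto simp: word_map_Cons map_comp_def fun_eq_iff split: option.splits)
qed (auto simp: word_map_Nil map_comp_def fun_eq_iff split: option.splits)

section \<open>Iterates of partial maps and periodic points\<close>

lemma iterate_0: "iterate R 0 = Some"
  by (simp add: iterate_def)

lemma iterate_Suc: "iterate R (Suc n) = R \<circ>\<^sub>m iterate R n"
  by (simp add: iterate_def)

lemma iterate_add: "iterate R (m + n) p = Option.bind (iterate R n p) (iterate R m)"
proof (induction m)
  case (Suc m)
  then show ?case
    by (simp add: iterate_Suc map_comp_def bind_eq_None_conv split: option.splits bind_split)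
qed (simp add: iterate_0)

text \<open>Periodic points of \<open>g\<close> become fixed points of one word. The power stays a
  literal concatenation, since reducing it in the group could enlarge the domain.\<close>

lemma iterate_word_map:
  "iterate (word_map g s z) n = word_map (concat (replicate n g)) s z"
  by (induction n) (simp_all add: iterate_0 iterate_Suc word_map_Nil word_map_append)

text \<open>The orbit returns at every multiple of a period \<open>m\<close>, and
  \<open>n * m\<close> is at least \<open>n\<close>: the \<open>n\<close>-th iterate is defined
  because a later one is.\<close>

lemma periodic_point_iterate_defined:
  assumes "periodic_point R p"
  shows "iterate R n p \<noteq> None"
proof -
  obtain m where m: "m > 0" "iterate R m p = Some p"
    using assms by (auto simp: periodic_point_def)
  have "iterate R (k * m) p = Some p" for k
    by (induction k) (simp_all add: iterate_0 iterate_add m)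
  then have "iterate R (n * m - n + n) p = Some p"
    using m(1) by simp
  then show ?thesis
    by (metis bind.bind_lunit iterate_add bind_eq_None_conv option.distinct(1))
qed

lemma iterate_period:
  assumes "periodic_point R p"
  shows "period R p > 0" "iterate R (period R p) p = Some p"
  using LeastI_ex[OF assms[unfolded periodic_point_def]] by (simp_all add: period_def)


section \<open>The displacement along an itinerary\<close>

text \<open>The constant term of a turn \<open>q -> -i q + (1 + i) r\<close> about a centre
  \<open>r\<close> of the unit grid. The factor \<open>1 + i\<close> makes a Gaussian integer of the
  half-integral centre.\<close>

definition offset :: "int \<times> int \<Rightarrow> complex" where
  "offset k = (1 + \<i>) * square_centre 1 0 k"

lemma offset_eq: "offset (m, n) = Complex (of_int (m - n)) (of_int (m + n + 1))"
  by (simp add: offset_def square_centre_def complex_eq_iff)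

lemma square_centre_eq: "square_centre s z k = z + of_real s * square_centre 1 0 k"
  by (simp add: square_centre_def split: prod.split)

primrec offset_sum :: "gen \<Rightarrow> (gen \<times> int \<times> int) list \<Rightarrow> complex" where
  "offset_sum a [] = 0"
| "offset_sum a (x # c) = - \<i> * offset_sum a c + (if fst x = a then offset (snd x) else 0)"

text \<open>For \<open>A2\<close> this is the coefficient of \<open>z\<close> in the composed map.
  For \<open>A1\<close> it is the coefficient a movable corner of the unit grid would have; it
  returns in \<open>offset_sum_approx\<close> with the moving point in that role.\<close>

primrec letter_sum :: "gen \<Rightarrow> gen list \<Rightarrow> complex" where
  "letter_sum a [] = 0"
| "letter_sum a (b # w) = - \<i> * letter_sum a w + (if b = a then 1 + \<i> else 0)"

text \<open>A centre is its grid's corner plus the side times a centre of the unit grid at 0, so the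
  choice of squares enters only through the two offset sums.\<close>

lemma follow_eq:
  "follow s z c p = (- \<i>) ^ length c * p + offset_sum A1 c + of_real s * offset_sum A2 c
     + z * letter_sum A2 (map fst c)"
proof (induction c)
  case (Cons x c)
  have "rot_cw r q = - \<i> * q + (1 + \<i>) * r" for r q
    by (simp add: rot_cw_def algebra_simps)
  then have F: "follow s z (x # c) p = - \<i> * follow s z c p + (1 + \<i>) * centre s z x"
    by simp
  have "(1 + \<i>) * centre s z x = (if fst x = A1 then offset (snd x) else 0)
      + of_real s * (if fst x = A2 then offset (snd x) else 0) + z * (if fst x = A2 then 1 + \<i> else 0)"
    by (subst square_centre_eq, cases "fst x") (simp_all add: offset_def algebra_simps)
  then show ?case
    unfolding F Cons by (cases "fst x") (simp_all add: algebra_simps)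
qed simp

lemma neg_ii_power: "4 dvd n \<Longrightarrow> (- \<i>) ^ n = 1"
  by (elim dvdE) (simp add: power_mult)

section \<open>Letter sums and the drift\<close>

lemma letter_sum_append:
  "letter_sum a (u @ v) = letter_sum a u + (- \<i>) ^ length u * letter_sum a v"
  by (induction u) (simp_all add: algebra_simps)

text \<open>The linear part of \<open>g\<close> is 1, so the contributions of the copies just add;
  hence positive powers of a drifter still drift.\<close>

lemma letter_sum_power:
  assumes "4 dvd length g"
  shows "letter_sum a (concat (replicate n g)) = of_nat n * letter_sum a g"
  by (induction n) (simp_all add: letter_sum_append neg_ii_power assms algebra_simps)

text \<open>A geometric series with ratio \<open>-i\<close>, as \<open>1 + i = 1 - (-i)\<close>. If
  4 divides the length, the two letter sums are opposite, which carries the drift over to the unit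
  grid.\<close>

lemma letter_sum_add: "letter_sum A1 w + letter_sum A2 w = 1 - (- \<i>) ^ length w"
proof (induction w)
  case (Cons b w)
  have "letter_sum A1 (b # w) + letter_sum A2 (b # w)
      = - \<i> * (letter_sum A1 w + letter_sum A2 w) + (1 + \<i>)"
    by (cases b) (simp_all add: algebra_simps)
  also have "\<dots> = 1 - (- \<i>) ^ length (b # w)"
    unfolding Cons by (simp add: algebra_simps)
  finally show ?case .
qed simp

text \<open>The conjugate appears because \<open>H\<close> turns counterclockwise and the squares
  turn clockwise: the constant term of the rotation about 1 is \<open>1 - i\<close>, not
  \<open>1 + i\<close>.\<close>

lemma H_eq: "H w p = \<i> ^ length w * p + cnj (letter_sum A2 w)"
proof (induction w)
  case Nil
  show ?case by (simp add: H_def Isom_def)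
next
  case (Cons a w)
  have "H (a # w) p = H_gen a (H w p)"
    by (simp add: H_def Isom_def)
  then show ?case
    unfolding Cons by (cases a) (simp_all add: rot_ccw_def algebra_simps)
qed

lemma drifter_iff: "drifter g \<longleftrightarrow> g \<in> G0 \<and> letter_sum A2 g \<noteq> 0"
proof -
  have "H g p = p + cnj (letter_sum A2 g)" if "g \<in> G0" for p
  proof -
    have "4 dvd length g" using that by (simp add: G0_def)
    then have "\<i> ^ length g = 1" by (elim dvdE) (simp add: power_mult)
    then show ?thesis by (simp add: H_eq)
  qed
  then show ?thesis by (auto simp: drifter_def fun_eq_iff)
qed

section \<open>Independence of 1 and an irrational side length\<close>

lemma offset_sum_Ints: "Re (offset_sum a c) \<in> \<int>" "Im (offset_sum a c) \<in> \<int>"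
proof -
  have "Re (offset k) \<in> \<int> \<and> Im (offset k) \<in> \<int>" for k
    by (cases k) (auto simp: offset_eq)
  then have "Re (offset_sum a c) \<in> \<int> \<and> Im (offset_sum a c) \<in> \<int>"
    by (induction c) auto
  then show "Re (offset_sum a c) \<in> \<int>" "Im (offset_sum a c) \<in> \<int>" by auto
qed

text \<open>1 and \<open>s\<close> are linearly independent over the rationals: two different
  representations would write \<open>s\<close> as a quotient of integers.\<close>

lemma irrational_Ints_unique:
  fixes s :: real
  assumes "s \<notin> \<rat>" "a \<in> \<int>" "b \<in> \<int>" "a' \<in> \<int>" "b' \<in> \<int>" "a + s * b = a' + s * b'"
  shows "a = a'"
proof (rule ccontr)
  assume "a \<noteq> a'"
  have "b - b' \<noteq> 0"
  proof
    assume "b - b' = 0"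
    then have "b = b'" by simp
    with assms(6) \<open>a \<noteq> a'\<close> show False by simp
  qed
  moreover have "s * (b - b') = a' - a"
    using assms(6) by (simp add: right_diff_distrib)
  ultimately have "s = (a' - a) / (b - b')"
    by (simp add: eq_divide_eq)
  moreover have "(a' - a) / (b - b') \<in> \<rat>"
    using assms(2-5) Ints_subset_Rats by (intro Rats_divide Rats_diff) (auto dest: subsetD)
  ultimately show False using assms(1) by simp
qed

lemma offset_sum_unique:
  assumes "s \<notin> \<rat>"
    and "offset_sum A1 c + of_real s * offset_sum A2 c = offset_sum A1 c' + of_real s * offset_sum A2 c'"
  shows "offset_sum A1 c = offset_sum A1 c'"
proof (rule complex_eqI)
  show "Re (offset_sum A1 c) = Re (offset_sum A1 c')"
    by (rule irrational_Ints_unique[OF assms(1), where b = "Re (offset_sum A2 c)"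
          and b' = "Re (offset_sum A2 c')"])
       (use arg_cong[OF assms(2), of Re] in \<open>simp_all add: offset_sum_Ints\<close>)
  show "Im (offset_sum A1 c) = Im (offset_sum A1 c')"
    by (rule irrational_Ints_unique[OF assms(1), where b = "Im (offset_sum A2 c)"
          and b' = "Im (offset_sum A2 c')"])
       (use arg_cong[OF assms(2), of Im] in \<open>simp_all add: offset_sum_Ints\<close>)
qed


section \<open>Periodic points of a given period form a bounded set\<close>

lemma dist_square_centre:
  assumes "p \<in> interior (grid_square s z k)"
  shows "dist p (square_centre s z k) \<le> s"
proof -
  obtain m n where k: "k = (m, n)" by (cases k)
  have "dist p (square_centre s z k) \<le> \<bar>Re (p - square_centre s z k)\<bar> + \<bar>Im (p - square_centre s z k)\<bar>"
    unfolding dist_norm by (rule cmod_le)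
  also have "\<dots> \<le> s / 2 + s / 2"
  proof (rule add_mono)
    have b: "Re z + s * m < Re p" "Re p < Re z + s * m + s" "Im z + s * n < Im p" "Im p < Im z + s * n + s"
      using assms by (simp_all add: k interior_grid_square algebra_simps)
    have "Re (p - square_centre s z k) = Re p - Re z - s * m - s / 2"
      "Im (p - square_centre s z k) = Im p - Im z - s * n - s / 2"
      by (simp_all add: k square_centre_def algebra_simps)
    with b show "\<bar>Re (p - square_centre s z k)\<bar> \<le> s / 2" "\<bar>Im (p - square_centre s z k)\<bar> \<le> s / 2"
      unfolding abs_le_iff by linarith+
  qed
  finally show ?thesis by simp
qed

text \<open>\<open>1 + s\<close> bounds both side lengths, so later estimates need not distinguish
  the letters.\<close>

lemma dist_tile_centre:
  assumes "s > 0" "p \<in> interior (tile s z x)"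
  shows "dist p (centre s z x) \<le> 1 + s"
  using dist_square_centre[OF assms(2)] assms(1) by (cases "fst x") auto

lemma dist_rot_cw: "dist (rot_cw r q) q \<le> 2 * dist q r"
proof -
  have "rot_cw r q - q = (1 + \<i>) * (r - q)"
    by (simp add: rot_cw_def algebra_simps)
  then have "dist (rot_cw r q) q = norm (1 + \<i>) * dist q r"
    by (simp add: dist_norm norm_mult norm_minus_commute)
  also have "norm (1 + \<i>) \<le> 2"
    using norm_triangle_ineq[of 1 "\<i>"] by simp
  finally show ?thesis by (simp add: mult_right_mono)
qed

lemma dist_follow:
  assumes "s > 0" "p \<in> cell s z c"
  shows "dist (follow s z c p) p \<le> 2 * (1 + s) * length c"
  using assms(2)
proof (induction c)
  case (Cons x c)
  let ?q = "follow s z c p"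
  have "dist (rot_cw (centre s z x) ?q) p \<le> dist (rot_cw (centre s z x) ?q) ?q + dist ?q p"
    by (rule dist_triangle)
  also have "\<dots> \<le> 2 * (1 + s) + 2 * (1 + s) * length c"
    using Cons dist_rot_cw[of "centre s z x" ?q] dist_tile_centre[OF assms(1), of ?q x z] by auto
  finally show ?case by (simp add: algebra_simps)
qed simp

lemma dist_head_centre:
  assumes "s > 0" "p \<in> cell s z (x # c)"
  shows "dist (centre s z x) p \<le> (1 + s) * (2 * length c + 1)"
proof -
  have "dist (centre s z x) p \<le> dist (follow s z c p) (centre s z x) + dist (follow s z c p) p"
    by (rule dist_triangle3)
  also have "\<dots> \<le> (1 + s) + 2 * (1 + s) * length c"
    using assms by (intro add_mono dist_tile_centre dist_follow) auto
  finally show ?thesis by (simp add: algebra_simps)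
qed

text \<open>Replacing every visited unit-grid centre by \<open>p\<close> turns the offset sum into
  the letter sum times \<open>p\<close>. The errors of the turns grow like the odd numbers
  \<open>2 * length c + 1\<close>, whose sum is the square of the length; the factor 4 leaves
  slack.\<close>

lemma offset_sum_approx:
  assumes "s > 0" "p \<in> cell s z c"
  shows "norm (offset_sum A1 c - letter_sum A1 (map fst c) * p) \<le> 4 * (1 + s) * (length c)\<^sup>2"
  using assms(2)
proof (induction c)
  case (Cons x c)
  let ?e = "\<lambda>c. offset_sum A1 c - letter_sum A1 (map fst c) * p"
  let ?d = "if fst x = A1 then (1 + \<i>) * (centre s z x - p) else 0"
  have "?e (x # c) = - \<i> * ?e c + ?d"
    by (auto simp: offset_def algebra_simps)
  then have "norm (?e (x # c)) \<le> norm (- \<i> * ?e c) + norm ?d"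
    by (simp only: norm_triangle_ineq)
  moreover have "norm (- \<i> * ?e c) = norm (?e c)"
    by (simp add: norm_mult)
  moreover have "norm (?e c) \<le> 4 * (1 + s) * (length c)\<^sup>2"
    using Cons by simp
  moreover have "norm ?d \<le> 2 * ((1 + s) * (2 * length c + 1))"
  proof -
    have "norm (1 + \<i>) \<le> 2"
      using norm_triangle_ineq[of 1 "\<i>"] by simp
    moreover have "norm (centre s z x - p) \<le> (1 + s) * (2 * length c + 1)"
      using dist_head_centre[OF assms(1) Cons.prems] by (simp only: dist_norm)
    ultimately have "norm ((1 + \<i>) * (centre s z x - p)) \<le> 2 * ((1 + s) * (2 * length c + 1))"
      unfolding norm_mult by (rule mult_mono) simp_all
    then show ?thesis using assms(1) by (cases "fst x") simp_all
  qed
  moreover have "4 * (1 + s) * (length c)\<^sup>2 + 2 * ((1 + s) * (2 * length c + 1))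
      \<le> 4 * (1 + s) * (length (x # c))\<^sup>2"
    using assms(1) by (simp add: algebra_simps power2_eq_square)
  ultimately show ?case by linarith
qed simp

text \<open>Two fixed points are compared: they share the unit-grid offset sum, which is near minus
  the drift times either point. So the drift times \<open>p - q\<close> is a difference of two
  bounded errors.\<close>

lemma fixed_points_bounded:
  assumes "s > 0" "s \<notin> \<rat>" "4 dvd length w" "letter_sum A2 w \<noteq> 0"
  shows "bounded {p. word_map w s z p = Some p}"
proof -
  let ?C = "4 * (1 + s) * (length w)\<^sup>2"
  let ?t = "norm (letter_sum A2 w)"
  have L: "letter_sum A1 w = - letter_sum A2 w"
    using letter_sum_add[of w] neg_ii_power[OF assms(3)] by (simp add: eq_neg_iff_add_eq_0)
  \<comment> \<open>The linear part is 1, so \<open>p\<close> cancels, leaving a right-hand side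
    common to all fixed points.\<close>
  have fixed: "offset_sum A1 c + of_real s * offset_sum A2 c = - (z * letter_sum A2 w)"
    if "map fst c = w" "follow s z c p = p" for c p
  proof -
    have "(- \<i>) ^ length c = 1"
      using neg_ii_power[OF assms(3)] that(1) by auto
    then show ?thesis
      using that by (simp add: follow_eq add.assoc) (simp add: eq_neg_iff_add_eq_0 add.assoc)
  qed
  have "dist p q \<le> 2 * ?C / ?t" if "word_map w s z p = Some p" "word_map w s z q = Some q" for p q
  proof -
    obtain c where c: "map fst c = w" "p \<in> cell s z c" "follow s z c p = p"
      using word_map_Some_cell[OF assms(1) \<open>word_map w s z p = Some p\<close>] .
    obtain d where d: "map fst d = w" "q \<in> cell s z d" "follow s z d q = q"
      using word_map_Some_cell[OF assms(1) \<open>word_map w s z q = Some q\<close>] .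
    have len: "length c = length w" "length d = length w"
      using c(1) d(1) by (metis length_map)+
    have "offset_sum A1 c + of_real s * offset_sum A2 c = - (z * letter_sum A2 w)"
      using fixed[OF c(1,3)] .
    moreover have "offset_sum A1 d + of_real s * offset_sum A2 d = - (z * letter_sum A2 w)"
      using fixed[OF d(1,3)] .
    ultimately have eq: "offset_sum A1 c = offset_sum A1 d"
      by (intro offset_sum_unique[OF assms(2)]) simp
    have "letter_sum A2 w * (p - q)
        = (offset_sum A1 c - letter_sum A1 w * p) - (offset_sum A1 d - letter_sum A1 w * q)"
      using eq by (simp add: L algebra_simps)
    then have "?t * dist p q
        = norm ((offset_sum A1 c - letter_sum A1 w * p) - (offset_sum A1 d - letter_sum A1 w * q))"
      by (metis dist_norm norm_mult)
    also have "\<dots> \<le> norm (offset_sum A1 c - letter_sum A1 w * p)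
        + norm (offset_sum A1 d - letter_sum A1 w * q)"
      by (rule norm_triangle_ineq4)
    also have "\<dots> \<le> ?C + ?C"
      using offset_sum_approx[OF assms(1) c(2)] offset_sum_approx[OF assms(1) d(2)]
      unfolding len c(1) d(1) by (rule add_mono)
    finally have "dist p q * ?t \<le> 2 * ?C"
      by (simp only: mult_2 mult.commute[of ?t])
    moreover have "?t > 0" using assms(4) by simp
    ultimately show ?thesis by (simp only: pos_le_divide_eq)
  qed
  then show ?thesis
    unfolding bounded_two_points by blast
qed

section \<open>Finitely many itineraries from a bounded set\<close>

lemma finite_squares_near:
  assumes "s > 0"
  shows "finite {k. norm (square_centre s z k) \<le> B}"
proof (rule finite_subset)
  \<comment> \<open>The added 1 absorbs the half by which the coordinates of a centre exceed the
    index.\<close>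
  define M where "M = \<lceil>(B + norm z) / s\<rceil> + 1"
  show "finite ({- M..M} \<times> {- M..M})" by simp
  show "{k. norm (square_centre s z k) \<le> B} \<subseteq> {- M..M} \<times> {- M..M}"
  proof
    fix k :: "int \<times> int"
    assume "k \<in> {k. norm (square_centre s z k) \<le> B}"
    then have k: "norm (square_centre s z k) \<le> B" by simp
    obtain m n where mn: "k = (m, n)" by (cases k)
    have "norm (of_real s * Complex (m + 1 / 2) (n + 1 / 2)) \<le> B + norm z"
      using k norm_triangle_ineq4[of "square_centre s z k" z]
      by (simp add: mn square_centre_def)
    then have le: "norm (Complex (m + 1 / 2) (n + 1 / 2)) \<le> (B + norm z) / s"
      using assms by (simp add: norm_mult field_simps)
    have "\<bar>m + 1 / 2\<bar> \<le> (B + norm z) / s" "\<bar>n + 1 / 2\<bar> \<le> (B + norm z) / s"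
      using abs_Re_le_cmod[of "Complex (m + 1 / 2) (n + 1 / 2)"]
        abs_Im_le_cmod[of "Complex (m + 1 / 2) (n + 1 / 2)"] le by simp_all
    then have "\<bar>m\<bar> \<le> M" "\<bar>n\<bar> \<le> M"
      unfolding M_def by linarith+
    then show "k \<in> {- M..M} \<times> {- M..M}" by (auto simp: mn)
  qed
qed

lemma finite_itineraries:
  assumes "s > 0" "bounded P"
  shows "finite {c. map fst c = w \<and> cell s z c \<inter> P \<noteq> {}}"
proof -
  obtain B where B: "\<And>p. p \<in> P \<Longrightarrow> norm p \<le> B"
    using assms(2) by (auto simp: bounded_iff)
  \<comment> \<open>The tail of an itinerary is shorter than \<open>w\<close>, so
    \<open>2 * length c + 1\<close> in \<open>dist_head_centre\<close> is at most
    \<open>2 * length w\<close>.\<close>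
  define B' where "B' = B + (1 + s) * (2 * length w)"
  let ?X = "{x. norm (centre s z x) \<le> B'}"
  have "finite (\<Union>a \<in> {A1, A2}. Pair a ` {k. norm (square_centre (side s a) (corner z a) k) \<le> B'})"
    using finite_squares_near[OF side_pos[OF assms(1)]] by blast
  moreover have "?X \<subseteq> (\<Union>a \<in> {A1, A2}. Pair a ` {k. norm (square_centre (side s a) (corner z a) k) \<le> B'})"
  proof
    fix x assume "x \<in> ?X"
    then show "x \<in> (\<Union>a \<in> {A1, A2}. Pair a ` {k. norm (square_centre (side s a) (corner z a) k) \<le> B'})"
      by (cases x; cases "fst x") auto
  qed
  ultimately have "finite ?X" by (rule rev_finite_subset)
  then have fin: "finite {c. set c \<subseteq> ?X \<and> length c = length w}"
    by (rule finite_lists_length_eq)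
  \<comment> \<open>The length is only bounded here, so that the induction can pass to
    tails.\<close>
  have sub: "set c \<subseteq> ?X" if "p \<in> cell s z c" "length c \<le> length w" "p \<in> P" for c p
    using that
  proof (induction c)
    case (Cons x c)
    have "norm (centre s z x) \<le> dist (centre s z x) p + norm p"
      by (metis dist_norm norm_triangle_sub add.commute)
    also have "\<dots> \<le> (1 + s) * (2 * length c + 1) + B"
      using Cons.prems assms(1) by (intro add_mono dist_head_centre B)
    also have "\<dots> \<le> B'"
      unfolding B'_def using Cons.prems assms(1) by (simp add: mult_left_mono)
    finally show ?case using Cons by auto
  qed simp
  have "{c. map fst c = w \<and> cell s z c \<inter> P \<noteq> {}} \<subseteq> {c. set c \<subseteq> ?X \<and> length c = length w}"
  proof
    fix c assume "c \<in> {c. map fst c = w \<and> cell s z c \<inter> P \<noteq> {}}"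
    then obtain p where p: "map fst c = w" "p \<in> cell s z c" "p \<in> P" by blast
    have "length c = length w" unfolding p(1)[symmetric] by simp
    with sub[OF p(2) _ p(3)] show "c \<in> {c. set c \<subseteq> ?X \<and> length c = length w}" by simp
  qed
  then show ?thesis
    by (rule finite_subset[OF _ fin])
qed


section \<open>Islands are cells\<close>

lemma follow_affine: "follow s z c p = (- \<i>) ^ length c * p + follow s z c 0"
  by (simp add: follow_eq)

lemma continuous_on_follow: "continuous_on A (follow s z c)"
proof -
  have "follow s z c = (\<lambda>p. (- \<i>) ^ length c * p + follow s z c 0)"
    using follow_affine by blast
  moreover have "continuous_on A (\<lambda>p. (- \<i>) ^ length c * p + b)" for b
    by (intro continuous_intros)
  ultimately show ?thesis by metis
qed

text \<open>Written as a translate of a linear image, a preimage inherits the results on polytopes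
  and interiors under such maps.\<close>

lemma affine_vimage:
  fixes u t :: complex
  assumes "u \<noteq> 0"
  shows "(\<lambda>p. u * p + t) -` A = (\<lambda>p. - (t / u) + p) ` (\<lambda>p. p / u) ` A"
proof (intro equalityI subsetI)
  fix p assume "p \<in> (\<lambda>p. u * p + t) -` A"
  moreover have "p = - (t / u) + (u * p + t) / u"
    using assms by (simp add: add_divide_distrib)
  ultimately show "p \<in> (\<lambda>p. - (t / u) + p) ` (\<lambda>p. p / u) ` A"
    by blast
next
  fix p assume "p \<in> (\<lambda>p. - (t / u) + p) ` (\<lambda>p. p / u) ` A"
  then obtain q where "q \<in> A" "p = - (t / u) + q / u" by blast
  then show "p \<in> (\<lambda>p. u * p + t) -` A"
    using assms by (simp add: right_diff_distrib)
qed

lemma follow_vimage: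
  "follow s z c -` A = (\<lambda>p. - (follow s z c 0 / (- \<i>) ^ length c) + p) `
     (\<lambda>p. p / (- \<i>) ^ length c) ` A"
proof -
  have "follow s z c = (\<lambda>p. (- \<i>) ^ length c * p + follow s z c 0)"
    using follow_affine by blast
  then have "follow s z c -` A = (\<lambda>p. (- \<i>) ^ length c * p + follow s z c 0) -` A"
    by (rule arg_cong)
  then show ?thesis
    by (simp only: affine_vimage[of "(- \<i>) ^ length c"] power_eq_0_iff neg_equal_0_iff_equal
        complex_i_not_zero simp_thms)
qed

text \<open>A finite intersection of rotated, translated open squares, and interiors commute with
  finite intersections. The empty itinerary is excluded: its cell is the whole plane, which is
  unbounded.\<close>

lemma cell_polytope:
  assumes "c \<noteq> []"
  shows "\<exists>P. polytope P \<and> cell s z c = interior P"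
  using assms
proof (induction c)
  case (Cons x c)
  let ?Q = "follow s z c -` tile s z x"
  let ?u = "(- \<i>) ^ length c"
  have lin: "linear (\<lambda>p. p / ?u)"
    by (simp add: linear_iff add_divide_distrib scaleR_conv_of_real)
  have inj: "inj (\<lambda>p. p / ?u)"
    by (auto simp: inj_def)
  have "polytope (tile s z x)"
    by (simp add: grid_square_def polytope_interval split: prod.split)
  then have Q: "polytope ?Q"
    unfolding follow_vimage polytope_translation_eq by (intro polytope_linear_image lin)
  have int: "interior ?Q = follow s z c -` interior (tile s z x)"
    unfolding follow_vimage interior_translation interior_injective_linear_image[OF lin inj] ..
  show ?case
  proof (cases "c = []")
    case True
    then show ?thesis using Q int by auto
  next
    case False
    then obtain P where "polytope P" "cell s z c = interior P"
      using Cons.IH by blast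
    then show ?thesis
      using Q int by (intro exI[of _ "P \<inter> ?Q"]) (simp add: polytope_Int)
  qed
qed simp

section \<open>Connected sets of defined points lie in one cell\<close>

lemma grid_squares_disjoint:
  assumes "s > 0" "p \<in> interior (grid_square s z k)" "p \<in> interior (grid_square s z l)"
  shows "k = l"
proof -
  \<comment> \<open>\<open>square_turn\<close> is single valued, so turning \<open>p\<close> about
    either centre gives the same image; the image in turn determines the centre.\<close>
  have "rot_cw (square_centre s z k) p = rot_cw (square_centre s z l) p"
    using square_turn_eq[OF assms(1,2)] square_turn_eq[OF assms(1,3)] by simp
  then have "(1 + \<i>) * square_centre s z k = (1 + \<i>) * square_centre s z l"
    by (simp add: rot_cw_def algebra_simps)
  moreover have "1 + \<i> \<noteq> 0" by (simp add: complex_eq_iff)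
  ultimately have "square_centre s z k = square_centre s z l"
    using mult_left_cancel by blast
  then show ?thesis
    using assms(1) by (cases k; cases l) (simp add: square_centre_def complex_eq_iff)
qed

text \<open>The chosen open square and the union of the others are disjoint open sets covering
  \<open>A\<close>, so they cannot both meet it.\<close>

lemma connected_subset_square:
  assumes "s > 0" "connected A" "A \<subseteq> (\<Union>k. interior (grid_square s z k))"
    and "p \<in> A" "p \<in> interior (grid_square s z k)"
  shows "A \<subseteq> interior (grid_square s z k)"
proof (rule ccontr)
  let ?V = "\<Union>l\<in>-{k}. interior (grid_square s z l)"
  assume "\<not> A \<subseteq> interior (grid_square s z k)"
  then obtain q l where q: "q \<in> A" "q \<notin> interior (grid_square s z k)" "q \<in> interior (grid_square s z l)"
    using assms(3) by (meson UN_E subset_eq)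
  then have V: "q \<in> ?V" by auto
  have disj: "interior (grid_square s z k) \<inter> ?V \<inter> A = {}"
  proof -
    have "r \<notin> ?V" if r: "r \<in> interior (grid_square s z k)" for r
    proof
      assume "r \<in> ?V"
      then obtain j where "j \<noteq> k" "r \<in> interior (grid_square s z j)" by blast
      then show False using grid_squares_disjoint[OF assms(1) r] by blast
    qed
    then show ?thesis by blast
  qed
  have cover: "A \<subseteq> interior (grid_square s z k) \<union> ?V"
  proof
    fix r assume "r \<in> A"
    then obtain j where "r \<in> interior (grid_square s z j)" using assms(3) by (meson UN_E subset_eq)
    then show "r \<in> interior (grid_square s z k) \<union> ?V" by (cases "j = k") auto
  qed
  have "interior (grid_square s z k) \<inter> A = {} \<or> ?V \<inter> A = {}"
    by (rule connectedD[OF assms(2) open_interior _ disj cover]) auto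
  then show False
    using IntI[OF assms(5,4)] IntI[OF V q(1)] by (elim disjE) (simp_all only: empty_iff)
qed

text \<open>On the cell of the tail the word map is continuous, so the image of \<open>U\<close> is
  connected; being turned by the next letter, it lies in open squares, hence in the one holding the
  image of \<open>p\<close>.\<close>

lemma connected_subset_cell:
  assumes "s > 0" "connected U" "p \<in> U" "p \<in> cell s z c"
    and "\<And>q. q \<in> U \<Longrightarrow> word_map (map fst c) s z q \<noteq> None"
  shows "U \<subseteq> cell s z c"
  using assms(4,5)
proof (induction c)
  case (Cons x c)
  have D: "word_map (map fst c) s z q \<noteq> None" if "q \<in> U" for q
    using Cons.prems(2)[OF that] by (auto simp: word_map_Cons map_comp_def split: option.splits)
  have sub: "U \<subseteq> cell s z c"
    using Cons.IH Cons.prems(1) D by auto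
  have "follow s z c ` U \<subseteq> interior (tile s z x)"
  proof (rule connected_subset_square)
    show "side s (fst x) > 0" using assms(1) by (rule side_pos)
    show "connected (follow s z c ` U)"
      by (intro connected_continuous_image continuous_on_follow assms(2))
    show "follow s z c p \<in> follow s z c ` U" using assms(3) by simp
    show "follow s z c p \<in> interior (tile s z x)" using Cons.prems(1) by simp
    show "follow s z c ` U \<subseteq> (\<Union>k. interior (grid_square (side s (fst x)) (corner z (fst x)) k))"
    proof clarify
      fix q assume q: "q \<in> U"
      then have "word_map (map fst c) s z q = Some (follow s z c q)"
        using word_map_cell[OF assms(1)] sub by blast
      with Cons.prems(2)[OF q] have "square_turn (side s (fst x)) (corner z (fst x)) (follow s z c q) \<noteq> None"
        by (simp add: word_map_Cons map_comp_def gen_map_eq)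
      then show "follow s z c q \<in> (\<Union>k. interior (grid_square (side s (fst x)) (corner z (fst x)) k))"
        by (auto simp: square_turn_def split: if_splits)
    qed
  qed
  with sub show ?case by auto
qed simp

text \<open>Connectedness puts the island inside the cell of \<open>p\<close>. That cell is itself a
  periodic polygon, so maximality of the island gives equality.\<close>

lemma periodic_island_cell:
  assumes "s > 0" "4 dvd length g" "g \<noteq> []"
    and "periodic_island (word_map g s z) p U" "n > 0" "iterate (word_map g s z) n p = Some p"
  obtains c where "map fst c = concat (replicate n g)" "p \<in> cell s z c" "U = cell s z c"
proof -
  let ?R = "word_map g s z" and ?w = "concat (replicate n g)"
  have U: "p \<in> U" "open_convex_polygon U" "\<And>q. q \<in> U \<Longrightarrow> periodic_point ?R q"
    and max: "\<And>V. periodic_polygon ?R V \<Longrightarrow> U \<subseteq> V \<Longrightarrow> V = U"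
    using assms(4) by (auto simp: periodic_island_def periodic_polygon_def)
  obtain c where c: "map fst c = ?w" "p \<in> cell s z c" "follow s z c p = p"
    using word_map_Some_cell[OF assms(1)] assms(6) unfolding iterate_word_map by blast
  have len: "length c = n * length g"
    using arg_cong[OF c(1), of length] by (simp add: length_concat sum_list_replicate)
  have "connected U"
    using U(2) unfolding open_convex_polygon_def
    by (metis convex_connected convex_interior polytope_imp_convex)
  then have sub: "U \<subseteq> cell s z c"
    using U c periodic_point_iterate_defined[of ?R]
    by (intro connected_subset_cell[OF assms(1)]) (auto simp flip: iterate_word_map)
  \<comment> \<open>The length is divisible by 4, so \<open>follow\<close> is a translation; fixing
    \<open>p\<close>, it is the identity.\<close>
  have "follow s z c q = q" for q
    using c(3) follow_affine[of s z c] neg_ii_power[of "length c"] assms(2) len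
    by (metis dvd_mult add_cancel_left_right mult_1)
  then have "periodic_point ?R q" if "q \<in> cell s z c" for q
    unfolding periodic_point_def iterate_word_map
    using word_map_cell[OF assms(1) that] c(1) assms(5) by metis
  moreover have "c \<noteq> []" using len assms(3,5) by auto
  ultimately have "periodic_polygon ?R (cell s z c)"
    using cell_polytope[of c s z] c(2) by (auto simp: periodic_polygon_def open_convex_polygon_def)
  then show ?thesis using that[OF c(1,2)] max[OF _ sub] by simp
qed

section \<open>Counting islands and exceptional corners \<open>z\<close>\<close>

theorem theorem1p3:
  fixes g :: "gen list" and s :: real
  assumes "drifter g" and "s > 0" and "s \<notin> \<rat>"
  shows "(\<forall>N::nat. \<forall>z::complex. N > 0 \<longrightarrow>
            finite {U. \<exists>p. periodic_point (word_map g s z) p \<and> period (word_map g s z) p < N \<and>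
                           periodic_island (word_map g s z) p U})
       \<and> countable {z::complex. \<exists>p. periodic_point (word_map g s z) p}"
proof (intro conjI allI impI)
  have g: "4 dvd length g" "letter_sum A2 g \<noteq> 0" "g \<noteq> []"
    using assms(1) by (auto simp: drifter_iff G0_def)
  have gn: "4 dvd length (concat (replicate n g))" for n
    using g(1) by (simp add: length_concat sum_list_replicate)
  have t: "letter_sum A2 (concat (replicate n g)) \<noteq> 0" if "n > 0" for n
    using that g(2) by (simp add: letter_sum_power[OF g(1)])
  {
    fix N z
    let ?R = "word_map g s z"
    let ?F = "\<lambda>n. {p. iterate ?R n p = Some p}"
    let ?I = "\<lambda>n. {c. map fst c = concat (replicate n g) \<and> cell s z c \<inter> ?F n \<noteq> {}}"
    \<comment> \<open>One finite family of cells for each possible period; 0 is left out because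
      periods are positive and the drift of the empty power vanishes.\<close>
    have "finite (\<Union>n\<in>{0<..<N}. cell s z ` ?I n)"
      using fixed_points_bounded[OF assms(2,3) gn t] finite_itineraries[OF assms(2)]
      by (auto simp: iterate_word_map)
    moreover have "{U. \<exists>p. periodic_point ?R p \<and> period ?R p < N \<and> periodic_island ?R p U}
        \<subseteq> (\<Union>n\<in>{0<..<N}. cell s z ` ?I n)"
    proof clarify
      fix U p
      assume p: "periodic_point ?R p" "period ?R p < N" "periodic_island ?R p U"
      let ?n = "period ?R p"
      note n = iterate_period[OF p(1)]
      obtain c where "map fst c = concat (replicate ?n g)" "p \<in> cell s z c" "U = cell s z c"
        using periodic_island_cell[OF assms(2) g(1,3) p(3) n] .
      then have "U \<in> cell s z ` ?I ?n" using n(2) by blast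
      moreover have "?n \<in> {0<..<N}" using n(1) p(2) by simp
      ultimately show "U \<in> (\<Union>n\<in>{0<..<N}. cell s z ` ?I n)" by blast
    qed
    ultimately show "finite {U. \<exists>p. periodic_point ?R p \<and> period ?R p < N \<and> periodic_island ?R p U}"
      by (rule rev_finite_subset)
  }
  \<comment> \<open>The only \<open>z\<close> for which an itinerary with nonzero letter sum can
    close up. If the letter sum is zero, division yields the harmless extra value 0.\<close>
  let ?f = "\<lambda>c. - (offset_sum A1 c + of_real s * offset_sum A2 c) / letter_sum A2 (map fst c)"
  have "(UNIV :: gen set) \<subseteq> {A1, A2}"
    using gen.exhaust by blast
  then have "countable (UNIV :: gen set)"
    using countable_finite finite_subset by blast
  then have "countable (lists ((UNIV :: gen set) \<times> (UNIV :: (int \<times> int) set)))"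
    by (intro countable_lists countable_SIGMA) auto
  then have "countable (range ?f)" by simp
  moreover have "{z. \<exists>p. periodic_point (word_map g s z) p} \<subseteq> range ?f"
  proof clarify
    fix z p assume "periodic_point (word_map g s z) p"
    then obtain n where n: "n > 0" "word_map (concat (replicate n g)) s z p = Some p"
      by (auto simp: periodic_point_def iterate_word_map)
    obtain c where c: "map fst c = concat (replicate n g)" "follow s z c p = p"
      using word_map_Some_cell[OF assms(2) n(2)] by metis
    have "4 dvd length c"
      using gn[of n] c(1) by (metis length_map)
    then have "offset_sum A1 c + of_real s * offset_sum A2 c + z * letter_sum A2 (map fst c) = 0"
      using c(2) by (simp add: follow_eq neg_ii_power add.assoc)
    then have "z * letter_sum A2 (map fst c) = - (offset_sum A1 c + of_real s * offset_sum A2 c)"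
      by (simp only: eq_neg_iff_add_eq_0 ac_simps)
    then have "z = ?f c"
      using t[OF n(1)] c(1) by (simp add: eq_divide_eq)
    then show "z \<in> range ?f" by blast
  qed
  ultimately show "countable {z. \<exists>p. periodic_point (word_map g s z) p}"
    by (rule countable_subset[rotated])
qed

end
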